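(* Let $T_4=\{(x,y)\in\mathbb{N}^2 : x+y\le 5\}$. Then $\mathrm{gon}(R(T_4))=6$.
   Context: $\mathbb{N}=\{1,2,3,\dots\}$. For a Ferrers diagram $F\subset\mathbb{N}^2$, the Ferrers rook graph $R(F)$ is the simple graph with vertex set $F$ in which distinct $(x,y),(x',y')$ are adjacent iff $x=x'$ or $y=y'$. Divisors on a graph: functions $D:V\to\mathbb{Z}$, degree $\sum_v D(v)$; firing a vertex $v$ means $v$ loses $\deg(v)$ chips and each neighbor gains one; divisors are equivalent if related by a sequence of firings; $\vert D\vert$ is the set of effective (nonnegative) divisors equivalent to $D$; $D$ has positive rank if for every vertex $v$ some $D'\in\vert D\vert$ has $D'(v)>0$. The gonality $\mathrm{gon}(G)$ is the minimum degree of a divisor on $G$ with positive rank. *)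

theory Defs
  imports Main
begin

text \<open>A finite simple graph is given by a vertex set V and a symmetric irreflexive
adjacency relation adj (only its restriction to V matters).
Divisors are integer functions on V, represented as functions vanishing outside V.\<close>

definition is_divisor :: "'a set \<Rightarrow> ('a \<Rightarrow> int) \<Rightarrow> bool" where
  "is_divisor V D \<longleftrightarrow> (\<forall>u. u \<notin> V \<longrightarrow> D u = 0)"

definition div_degree :: "'a set \<Rightarrow> ('a \<Rightarrow> int) \<Rightarrow> int" where
  "div_degree V D = (\<Sum>v\<in>V. D v)"

definition vdeg :: "'a set \<Rightarrow> ('a \<Rightarrow> 'a \<Rightarrow> bool) \<Rightarrow> 'a \<Rightarrow> nat" where
  "vdeg V adj v = card {u \<in> V. adj v u}"

definition fire :: "'a set \<Rightarrow> ('a \<Rightarrow> 'a \<Rightarrow> bool) \<Rightarrow> 'a \<Rightarrow> ('a \<Rightarrow> int) \<Rightarrow> ('a \<Rightarrow> int)" where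
  "fire V adj v D = (\<lambda>u. if u = v then D u - int (vdeg V adj v)
                          else if u \<in> V \<and> adj v u then D u + 1 else D u)"

text \<open>One firing move (in either direction, so that the generated relation is an
equivalence relation).\<close>
definition fire_step :: "'a set \<Rightarrow> ('a \<Rightarrow> 'a \<Rightarrow> bool) \<Rightarrow> ('a \<Rightarrow> int) \<Rightarrow> ('a \<Rightarrow> int) \<Rightarrow> bool" where
  "fire_step V adj D D' \<longleftrightarrow> (\<exists>v\<in>V. D' = fire V adj v D \<or> D = fire V adj v D')"

definition div_equiv :: "'a set \<Rightarrow> ('a \<Rightarrow> 'a \<Rightarrow> bool) \<Rightarrow> ('a \<Rightarrow> int) \<Rightarrow> ('a \<Rightarrow> int) \<Rightarrow> bool" where
  "div_equiv V adj D D' \<longleftrightarrow> (fire_step V adj)\<^sup>*\<^sup>* D D'"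

definition effective :: "'a set \<Rightarrow> ('a \<Rightarrow> int) \<Rightarrow> bool" where
  "effective V D \<longleftrightarrow> (\<forall>v\<in>V. D v \<ge> 0)"

definition linsys :: "'a set \<Rightarrow> ('a \<Rightarrow> 'a \<Rightarrow> bool) \<Rightarrow> ('a \<Rightarrow> int) \<Rightarrow> ('a \<Rightarrow> int) set" where
  "linsys V adj D = {D'. div_equiv V adj D D' \<and> effective V D'}"

definition positive_rank :: "'a set \<Rightarrow> ('a \<Rightarrow> 'a \<Rightarrow> bool) \<Rightarrow> ('a \<Rightarrow> int) \<Rightarrow> bool" where
  "positive_rank V adj D \<longleftrightarrow> (\<forall>v\<in>V. \<exists>D'\<in>linsys V adj D. D' v > 0)"

text \<open>Gonality: minimum degree of a divisor of positive rank. (Such divisors have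
nonnegative degree, as they are equivalent to an effective divisor and firing
preserves degree, so the minimum is taken over natural numbers.)\<close>
definition gonality :: "'a set \<Rightarrow> ('a \<Rightarrow> 'a \<Rightarrow> bool) \<Rightarrow> nat" where
  "gonality V adj = (LEAST k::nat. \<exists>D. is_divisor V D \<and> div_degree V D = int k
                                       \<and> positive_rank V adj D)"

text \<open>Ferrers rook graph on F, a subset of N x N with N = {1,2,...}.\<close>
definition rook_adj :: "nat \<times> nat \<Rightarrow> nat \<times> nat \<Rightarrow> bool" where
  "rook_adj p q \<longleftrightarrow> p \<noteq> q \<and> (fst p = fst q \<or> snd p = snd q)"

definition T4 :: "(nat \<times> nat) set" where
  "T4 = {(x, y). 1 \<le> x \<and> 1 \<le> y \<and> x + y \<le> 5}"

end

theory Submission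
  imports Defs
begin

text \<open>
  The cells with \<open>x + y \<le> 4\<close> carry a divisor of degree 6 and positive rank: the four remaining cells
  are pairwise nonadjacent, and firing everything but one of them is legal.

  Conversely, let \<open>D\<close> be an effective divisor of positive rank and degree at most 5, reduced at the
  corner \<open>(1,1)\<close>. For every cell \<open>q\<close> without chips there is a legal firing set avoiding \<open>q\<close>; it contains
  the corner, so its complement \<open>A\<close> contains \<open>q\<close>, avoids the corner and has an edge cut of size at most 5.
  Such an \<open>A\<close> is a single cell or an adjacent pair of cells with cut exactly 5. At least 5 cells are
  chip-free while independent sets have at most 4 elements, so some \<open>A\<close> is a pair. Then all chips lie next
  to \<open>A\<close>, and three connected chip-free cells far from \<open>A\<close> must lie in a common set of the same kind, which
  is too small for them.
\<close>

section \<open>Firing scripts and the graph Laplacian\<close>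

definition nbrs :: "'a set \<Rightarrow> ('a \<Rightarrow> 'a \<Rightarrow> bool) \<Rightarrow> 'a \<Rightarrow> 'a set" where
  "nbrs V adj u = {w \<in> V. adj u w}"

text \<open>The sign is opposite to that of the positive semidefinite Laplacian: adding
  \<open>lapl V adj f\<close> to a divisor fires each vertex \<open>u\<close> exactly
  \<open>f u\<close> times.\<close>

definition lapl :: "'a set \<Rightarrow> ('a \<Rightarrow> 'a \<Rightarrow> bool) \<Rightarrow> ('a \<Rightarrow> int) \<Rightarrow> 'a \<Rightarrow> int" where
  "lapl V adj f u = (\<Sum>w\<in>nbrs V adj u. f w - f u)"

text \<open>The guard leaves values outside \<open>V\<close> untouched, as firing a vertex of
  \<open>V\<close> does; \<open>lapl\<close> need not vanish there.\<close>

definition fire_script ::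
  "'a set \<Rightarrow> ('a \<Rightarrow> 'a \<Rightarrow> bool) \<Rightarrow> ('a \<Rightarrow> int) \<Rightarrow> ('a \<Rightarrow> int) \<Rightarrow> ('a \<Rightarrow> int)" where
  "fire_script V adj f D = (\<lambda>u. if u \<in> V then D u + lapl V adj f u else D u)"

lemma fire_script_0 [simp]: "fire_script V adj (\<lambda>_. 0) D = D"
  by (auto simp: fire_script_def lapl_def)

lemma fire_script_add:
  "fire_script V adj g (fire_script V adj f D) = fire_script V adj (\<lambda>u. f u + g u) D"
  by (simp add: fire_script_def lapl_def fun_eq_iff sum_subtractf sum.distrib distrib_left)

lemma fire_step_sym: "fire_step V adj D D' \<Longrightarrow> fire_step V adj D' D"
  by (auto simp: fire_step_def)

lemma div_equiv_sym:
  assumes "div_equiv V adj D D'" shows "div_equiv V adj D' D"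
  using assms unfolding div_equiv_def
  by (induction rule: rtranclp_induct) (auto intro: converse_rtranclp_into_rtranclp fire_step_sym)

lemma div_equiv_trans:
  "div_equiv V adj D D' \<Longrightarrow> div_equiv V adj D' D'' \<Longrightarrow> div_equiv V adj D D''"
  unfolding div_equiv_def by (rule rtranclp_trans)

locale finite_simple_graph =
  fixes V :: "'a set" and adj :: "'a \<Rightarrow> 'a \<Rightarrow> bool"
  assumes finite_V: "finite V"
    and adj_sym: "adj u w \<Longrightarrow> adj w u"
    and adj_irrefl: "\<not> adj u u"
begin

lemma finite_nbrs: "finite (nbrs V adj u)"
  using finite_V by (simp add: nbrs_def)

lemma fire_eq_fire_script:
  assumes "v \<in> V"
  shows "fire V adj v D = fire_script V adj (\<lambda>u. if u = v then 1 else 0) D"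
proof
  fix u
  have "lapl V adj (\<lambda>u. if u = v then 1 else 0) v = - int (vdeg V adj v)"
  proof -
    have "lapl V adj (\<lambda>u. if u = v then 1 else 0) v = (\<Sum>w\<in>nbrs V adj v. - 1)"
      unfolding lapl_def by (rule sum.cong) (auto simp: nbrs_def adj_irrefl)
    then show ?thesis by (simp add: vdeg_def nbrs_def)
  qed
  moreover have "lapl V adj (\<lambda>u. if u = v then 1 else 0) u = (if adj v u then 1 else 0)"
    if "u \<noteq> v"
    using that assms adj_sym by (auto simp: lapl_def finite_nbrs) (auto simp: nbrs_def)
  ultimately show "fire V adj v D u = fire_script V adj (\<lambda>u. if u = v then 1 else 0) D u"
    using assms by (auto simp: fire_def fire_script_def)
qed

lemma div_equiv_imp_fire_script:
  assumes "div_equiv V adj D D'"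
  obtains f where "D' = fire_script V adj f D"
proof -
  have "\<exists>f. D' = fire_script V adj f D"
    using assms unfolding div_equiv_def
  proof (induction rule: rtranclp_induct)
    case base
    show ?case by (rule exI[of _ "\<lambda>_. 0"]) simp
  next
    case (step D1 D2)
    then obtain f where f: "D1 = fire_script V adj f D" by blast
    from step.hyps(2) obtain v where v: "v \<in> V" "D2 = fire V adj v D1 \<or> D1 = fire V adj v D2"
      by (auto simp: fire_step_def)
    define e :: "'a \<Rightarrow> int" where "e = (\<lambda>u. if u = v then 1 else 0)"
    have "D2 = fire_script V adj e D1 \<or> D1 = fire_script V adj e D2"
      using v fire_eq_fire_script e_def by auto
    \<comment> \<open>A backward move is inverted by the negated script.\<close>
    moreover have "fire_script V adj (\<lambda>u. - e u) (fire_script V adj e D2) = D2"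
      by (simp add: fire_script_add)
    ultimately have "D2 = fire_script V adj e D1 \<or> D2 = fire_script V adj (\<lambda>u. - e u) D1"
      by metis
    then show ?case unfolding f fire_script_add by blast
  qed
  then show ?thesis using that by blast
qed

text \<open>The vertices of \<open>U\<close> are fired one at a time; debt on the way is harmless,
  since \<open>div_equiv\<close> does not ask for effectiveness.\<close>

lemma div_equiv_fire_set:
  assumes "U \<subseteq> V"
  shows "div_equiv V adj D (fire_script V adj (\<lambda>u. if u \<in> U then 1 else 0) D)"
proof -
  have "finite U" using assms finite_V by (rule finite_subset)
  then show ?thesis using assms
  proof (induction U)
    case empty
    show ?case by (simp add: div_equiv_def)
  next
    case (insert v U)
    let ?D = "fire_script V adj (\<lambda>u. if u \<in> U then 1 else 0) D"
    have "(\<lambda>u. (if u \<in> U then 1 else 0) + (if u = v then 1 else (0::int))) =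
        (\<lambda>u. if u \<in> insert v U then 1 else 0)"
      using insert.hyps by auto
    then have "fire V adj v ?D = fire_script V adj (\<lambda>u. if u \<in> insert v U then 1 else 0) D"
      using insert.prems by (simp add: fire_eq_fire_script fire_script_add)
    moreover have "fire_step V adj ?D (fire V adj v ?D)"
      using insert.prems by (auto simp: fire_step_def)
    ultimately show ?case
      using insert by (auto simp: div_equiv_def)
  qed
qed

section \<open>Weighted degrees, legal firing sets and reduced divisors\<close>

lemma lapl_self_adjoint: "(\<Sum>u\<in>V. g u * lapl V adj f u) = (\<Sum>u\<in>V. f u * lapl V adj g u)"
proof -
  have expand: "(\<Sum>u\<in>V. g u * lapl V adj f u) =
      (\<Sum>u\<in>V. \<Sum>w\<in>V. if adj u w then g u * f w else 0) -
      (\<Sum>u\<in>V. \<Sum>w\<in>V. if adj u w then g u * f u else 0)" for f g :: "'a \<Rightarrow> int"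
    by (simp add: lapl_def nbrs_def sum_distrib_left sum.inter_filter finite_V
        flip: sum_subtractf) (intro sum.cong, auto simp: algebra_simps)
  have "(\<Sum>u\<in>V. \<Sum>w\<in>V. if adj u w then g u * f w else 0) =
      (\<Sum>u\<in>V. \<Sum>w\<in>V. if adj u w then f u * g w else 0)"
    by (subst sum.swap) (intro sum.cong, auto simp: adj_sym)
  then show ?thesis unfolding expand by (simp only: mult.commute)
qed

text \<open>The constant weight 1 gives invariance of the degree; a subharmonic weight measures the
  progress made by a firing.\<close>

lemma weighted_degree_fire_script:
  "(\<Sum>u\<in>V. g u * fire_script V adj f D u) = (\<Sum>u\<in>V. g u * D u) + (\<Sum>u\<in>V. f u * lapl V adj g u)"
  using lapl_self_adjoint[of g f] by (simp add: fire_script_def distrib_left sum.distrib)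

lemma div_degree_equiv:
  assumes "div_equiv V adj D D'" shows "div_degree V D' = div_degree V D"
proof -
  obtain f where "D' = fire_script V adj f D"
    using assms by (rule div_equiv_imp_fire_script)
  then show ?thesis
    using weighted_degree_fire_script[of "\<lambda>_. 1" f D] by (simp add: div_degree_def lapl_def)
qed

text \<open>The set of vertices where a firing script is maximal can be fired without creating debt.\<close>

lemma exists_legal_firing_set:
  assumes equiv: "div_equiv V adj D D'" and eff: "effective V D" "effective V D'"
    and q: "q \<in> V" "D q < D' q"
  obtains U where "U \<subseteq> V" "U \<noteq> {}" "q \<notin> U" "\<And>u. u \<in> U \<Longrightarrow> int (card (nbrs V adj u - U)) \<le> D u"
proof -
  obtain f where f: "D' = fire_script V adj f D"
    using equiv by (rule div_equiv_imp_fire_script)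
  define m where "m = Max (f ` V)"
  define U where "U = {u \<in> V. f u = m}"
  have le: "f u \<le> m" if "u \<in> V" for u
    using that finite_V by (simp add: m_def)
  have "m \<in> f ` V"
    using finite_V q unfolding m_def by (intro Max_in) auto
  then have "U \<noteq> {}" by (auto simp: U_def)
  moreover have "q \<notin> U"
  proof
    assume "q \<in> U"
    \<comment> \<open>No neighbour of a maximiser has a larger value, so \<open>q\<close> cannot
      gain chips.\<close>
    then have "lapl V adj f q \<le> 0"
      unfolding lapl_def by (intro sum_nonpos) (auto simp: U_def nbrs_def le)
    then show False using q f by (simp add: fire_script_def)
  qed
  moreover have "int (card (nbrs V adj u - U)) \<le> D u" if "u \<in> U" for u
  proof -
    \<comment> \<open>By integrality \<open>f\<close> drops by at least 1 across every edge leaving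
      \<open>U\<close>, so \<open>u\<close> pays at least one chip per such edge and still ends
      without debt in \<open>D'\<close>.\<close>
    have "lapl V adj f u \<le> (\<Sum>w\<in>nbrs V adj u. if w \<in> U then 0 else - 1)"
      unfolding lapl_def
    proof (intro sum_mono)
      fix w assume "w \<in> nbrs V adj u"
      then show "f w - f u \<le> (if w \<in> U then 0 else - 1)"
        using that le[of w] by (auto simp: U_def nbrs_def)
    qed
    also have "\<dots> = - int (card (nbrs V adj u - U))"
      by (simp add: sum.If_cases finite_nbrs Diff_eq)
    finally show ?thesis
      using f eff(2) that by (auto simp: fire_script_def effective_def U_def)
  qed
  ultimately show ?thesis using that[of U] by (auto simp: U_def)
qed

text \<open>A vertex of \<open>U\<close> loses one chip along each edge leaving \<open>U\<close>,
  which the hypothesis covers; every other vertex can only gain.\<close>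

lemma effective_fire_set:
  assumes "U \<subseteq> V" "effective V D" "\<And>u. u \<in> U \<Longrightarrow> int (card (nbrs V adj u - U)) \<le> D u"
  shows "effective V (fire_script V adj (\<lambda>u. if u \<in> U then 1 else 0) D)"
  unfolding effective_def
proof
  fix u assume "u \<in> V"
  show "0 \<le> fire_script V adj (\<lambda>u. if u \<in> U then 1 else 0) D u"
  proof (cases "u \<in> U")
    case True
    then have "lapl V adj (\<lambda>u. if u \<in> U then 1 else 0) u = (\<Sum>w\<in>nbrs V adj u. if w \<in> U then 0 else - 1)"
      unfolding lapl_def by (intro sum.cong) auto
    also have "\<dots> = - int (card (nbrs V adj u - U))"
      by (simp add: sum.If_cases finite_nbrs Diff_eq)
    finally show ?thesis using assms(3)[OF True] \<open>u \<in> V\<close> by (simp add: fire_script_def)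
  next
    case False
    then have "lapl V adj (\<lambda>u. if u \<in> U then 1 else 0) u \<ge> 0"
      unfolding lapl_def by (intro sum_nonneg) auto
    then show ?thesis using assms(2) \<open>u \<in> V\<close> by (simp add: fire_script_def effective_def)
  qed
qed

text \<open>A function that is strictly subharmonic away from \<open>q0\<close> increases along every legal firing of
  a set avoiding \<open>q0\<close>, so a maximiser of the corresponding weighted degree is \<open>q0\<close>-reduced.\<close>

lemma exists_reduced_divisor:
  assumes rank: "positive_rank V adj D0" and "q0 \<in> V"
    and subharmonic: "\<And>u. u \<in> V \<Longrightarrow> u \<noteq> q0 \<Longrightarrow> lapl V adj g u > 0"
    and bounds: "\<And>u. u \<in> V \<Longrightarrow> 0 \<le> g u" "\<And>u. u \<in> V \<Longrightarrow> g u \<le> c"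
  obtains D where "effective V D" "div_degree V D = div_degree V D0" "D q0 > 0"
    "\<And>q. q \<in> V \<Longrightarrow> D q = 0 \<Longrightarrow> \<exists>U\<subseteq>V. q0 \<in> U \<and> q \<notin> U \<and>
       (\<forall>u\<in>U. int (card (nbrs V adj u - U)) \<le> D u)"
proof -
  define W where "W = (\<lambda>D :: 'a \<Rightarrow> int. \<Sum>u\<in>V. g u * D u)"
  have "linsys V adj D0 \<noteq> {}"
    using rank \<open>q0 \<in> V\<close> by (auto simp: positive_rank_def)
  then obtain D1 where D1: "D1 \<in> linsys V adj D0" by blast
  have bound: "W D \<le> c * div_degree V D0" if "D \<in> linsys V adj D0" for D
  proof -
    have "W D \<le> (\<Sum>u\<in>V. c * D u)"
      unfolding W_def using that bounds
      by (intro sum_mono mult_right_mono) (auto simp: linsys_def effective_def)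
    also have "\<dots> = c * div_degree V D"
      by (simp add: div_degree_def sum_distrib_left)
    finally show ?thesis using that div_degree_equiv[of D0 D] by (simp add: linsys_def)
  qed
  have nonneg: "0 \<le> W D" if "D \<in> linsys V adj D0" for D
    unfolding W_def using that bounds(1)
    by (intro sum_nonneg mult_nonneg_nonneg) (auto simp: linsys_def effective_def)
  \<comment> \<open>On the linear system \<open>W\<close> lies between 0 and \<open>c\<close> times
    the degree, so a maximiser exists; nonnegativity lets the comparison pass through
    \<open>nat\<close>.\<close>
  have "\<exists>D. D \<in> linsys V adj D0 \<and>
      (\<forall>D'. D' \<in> linsys V adj D0 \<longrightarrow> nat (W D') \<le> nat (W D))"
  proof (rule ex_has_greatest_nat)
    show "\<forall>D'. D' \<in> linsys V adj D0 \<longrightarrow> nat (W D') < Suc (nat (c * div_degree V D0))"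
      using bound by (auto simp: less_Suc_eq_le intro: nat_mono)
  qed (rule D1)
  then obtain D where D: "D \<in> linsys V adj D0"
    and max_nat: "\<And>D'. D' \<in> linsys V adj D0 \<Longrightarrow> nat (W D') \<le> nat (W D)"
    by blast
  have max: "W D' \<le> W D" if "D' \<in> linsys V adj D0" for D'
    using max_nat[OF that] nonneg[OF D] by simp
  have eff: "effective V D" and equiv: "div_equiv V adj D0 D"
    using D by (auto simp: linsys_def)
  have legal: "\<exists>U\<subseteq>V. q0 \<in> U \<and> q \<notin> U \<and> (\<forall>u\<in>U. int (card (nbrs V adj u - U)) \<le> D u)"
    if q: "q \<in> V" "D q = 0" for q
  proof -
    obtain D' where D': "D' \<in> linsys V adj D0" "D' q > 0"
      using rank q by (auto simp: positive_rank_def)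
    then have "div_equiv V adj D D'" "effective V D'"
      using div_equiv_trans[OF div_equiv_sym[OF equiv]] by (auto simp: linsys_def)
    moreover have "D q < D' q" using q D' by simp
    ultimately obtain U where U: "U \<subseteq> V" "U \<noteq> {}" "q \<notin> U"
      and le: "\<And>u. u \<in> U \<Longrightarrow> int (card (nbrs V adj u - U)) \<le> D u"
      using exists_legal_firing_set[OF _ eff _ q(1)] by metis
    have "q0 \<in> U"
    proof (rule ccontr)
      assume "q0 \<notin> U"
      \<comment> \<open>Firing \<open>U\<close> stays in the linear system and raises
        \<open>W\<close> by the sum of \<open>lapl V adj g\<close> over \<open>U\<close>, against
        maximality.\<close>
      let ?D = "fire_script V adj (\<lambda>u. if u \<in> U then 1 else 0) D"
      have "?D \<in> linsys V adj D0"
        using effective_fire_set[OF U(1) eff le] div_equiv_fire_set[OF U(1)] equiv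
        by (auto simp: linsys_def intro: div_equiv_trans)
      then have "W ?D \<le> W D" by (rule max)
      moreover have "(\<Sum>u\<in>V. (if u \<in> U then 1 else 0) * lapl V adj g u) = (\<Sum>u\<in>U. lapl V adj g u)"
        using U(1) finite_V by (simp add: if_distrib[of "\<lambda>x. x * _"] sum.If_cases Int_absorb1 cong: if_cong)
      moreover have "(\<Sum>u\<in>U. lapl V adj g u) > 0"
        using U \<open>q0 \<notin> U\<close> finite_subset[OF U(1) finite_V] subharmonic by (intro sum_pos) auto
      ultimately show False
        by (simp add: W_def weighted_degree_fire_script)
    qed
    then show ?thesis using U le by blast
  qed
  \<comment> \<open>Without a chip on \<open>q0\<close>, \<open>legal\<close> would give a set both
    containing and omitting \<open>q0\<close>.\<close>
  moreover have "D q0 > 0"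
    using legal[OF \<open>q0 \<in> V\<close>] eff \<open>q0 \<in> V\<close> by (force simp: effective_def)
  ultimately show ?thesis
    using that eff div_degree_equiv[OF equiv] by blast
qed

end

section \<open>The rook graph on \<open>T4\<close>: potential, small cuts, independent sets\<close>

definition cells :: "(nat \<times> nat) list" where
  "cells = [(1,1),(1,2),(1,3),(1,4),(2,1),(2,2),(2,3),(3,1),(3,2),(4,1)]"

lemma T4_eq: "T4 = set cells"
proof -
  have "T4 = set (filter (\<lambda>(x, y). x + y \<le> 5) (List.product [1..<5] [1..<5]))"
    by (auto simp: T4_def)
  also have "filter (\<lambda>(x, y). x + y \<le> 5) (List.product [1..<5] [1..<5]) = cells"
    by code_simp
  finally show ?thesis .
qed

lemma distinct_cells: "distinct cells"
  by (simp add: cells_def)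

lemma card_T4: "card T4 = 10"
  unfolding T4_eq distinct_card[OF distinct_cells] by (simp add: cells_def)

interpretation T4: finite_simple_graph T4 rook_adj
  by unfold_locales (auto simp: T4_eq rook_adj_def)

text \<open>A border cell other than the corner gains 3 from the corner and loses at most 2 to
  interior cells in its line; an interior cell gains 2 from its two border neighbours. A corner
  value of 3 would be too small.\<close>

definition potential :: "nat \<times> nat \<Rightarrow> int" where
  "potential = (\<lambda>(x, y). if x = 1 \<and> y = 1 then 4 else if x = 1 \<or> y = 1 then 1 else 0)"

lemma potential_subharmonic:
  assumes "u \<in> T4" "u \<noteq> (1,1)"
  shows "lapl T4 rook_adj potential u > 0"
proof -
  have "\<forall>u\<in>set cells. u \<noteq> (1,1) \<longrightarrow>
      sum_list (map (\<lambda>w. potential w - potential u) (filter (rook_adj u) cells)) > 0"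
    by code_simp
  moreover have "nbrs T4 rook_adj u = set (filter (rook_adj u) cells)"
    by (auto simp: nbrs_def T4_eq)
  ultimately show ?thesis
    using assms distinct_cells by (simp add: lapl_def T4_eq sum_list_distinct_conv_sum_set)
qed

text \<open>The size of the edge cut of \<open>A\<close>, counted by outer endpoints because the
  chips there bound it cell by cell.\<close>

definition rook_cut :: "(nat \<times> nat) set \<Rightarrow> nat" where
  "rook_cut A = (\<Sum>u\<in>T4 - A. card {w \<in> A. rook_adj u w})"

definition far :: "(nat \<times> nat) set \<Rightarrow> (nat \<times> nat) set" where
  "far A = {u \<in> T4 - A. \<forall>w\<in>A. \<not> rook_adj u w}"

text \<open>Exhaustive evaluation over the 512 subsets of the nine cells other than the corner,
  which heads \<open>cells\<close>. The last clause supplies the three connected cells far from a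
  pair.\<close>

lemma low_cut_lists:
  "let cs = cells in \<forall>as\<in>set (subseqs (tl cs)).
    let bs = filter (\<lambda>u. u \<notin> set as) cs;
        c = sum_list (map (\<lambda>u. length (filter (rook_adj u) as)) bs)
    in c \<le> 5 \<longrightarrow> as \<noteq> [] \<longrightarrow> length as = 1 \<or>
      (length as = 2 \<and> c = 5 \<and>
       (let fs = filter (\<lambda>u. \<forall>w\<in>set as. \<not> rook_adj u w) bs
        in \<exists>x\<in>set fs. length (filter (rook_adj x) fs) \<ge> 2))"
  by code_simp

text \<open>The pairs that occur consist of adjacent cells on the two outermost diagonals.\<close>

lemma low_cut:
  assumes "A \<subseteq> T4 - {(1,1)}" "A \<noteq> {}" "rook_cut A \<le> 5"
  shows "card A = 1 \<or>
    (card A = 2 \<and> rook_cut A = 5 \<and> (\<exists>x\<in>far A. card {y \<in> far A. rook_adj x y} \<ge> 2))"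
proof -
  have "T4 - {(1,1)} = set (tl cells)"
    unfolding T4_eq by (auto simp: cells_def)
  then have "A \<in> set ` set (subseqs (tl cells))"
    using assms(1) by (simp add: subseqs_powset)
  then obtain as where as: "as \<in> set (subseqs (tl cells))" and A: "A = set as" by blast
  have dist: "distinct as"
    using subseqs_distinctD[OF as] distinct_cells by (simp add: distinct_tl)
  define bs where "bs = filter (\<lambda>u. u \<notin> set as) cells"
  define fs where "fs = filter (\<lambda>u. \<forall>w\<in>set as. \<not> rook_adj u w) bs"
  have bs: "set bs = T4 - A" "distinct bs" and fs: "set fs = far A" "distinct fs"
    using distinct_cells by (auto simp: bs_def fs_def far_def T4_eq A)
  have len: "length (filter (rook_adj u) xs) = card {w \<in> set xs. rook_adj u w}"
    if "distinct xs" for u xs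
    using distinct_card[of "filter (rook_adj u) xs"] that by simp
  have "sum_list (map (\<lambda>u. length (filter (rook_adj u) as)) bs) = rook_cut A"
    unfolding rook_cut_def by (simp add: sum_list_distinct_conv_sum_set bs len[OF dist] A)
  moreover have "length as = card A" using dist by (simp add: A distinct_card)
  moreover have "as \<noteq> []" using assms(2) A by auto
  ultimately show ?thesis
    using low_cut_lists[unfolded Let_def, THEN bspec, OF as, folded bs_def, folded fs_def] assms(3)
    by (simp add: len[OF fs(2)] fs(1))
qed

text \<open>Cells with equal first coordinate are adjacent, so an independent set injects into the
  four possible values.\<close>

lemma card_independent_le_4:
  assumes "Z \<subseteq> T4" "\<And>u w. u \<in> Z \<Longrightarrow> w \<in> Z \<Longrightarrow> \<not> rook_adj u w"
  shows "card Z \<le> 4"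
proof -
  have "inj_on fst Z"
    using assms(2) by (auto simp: inj_on_def rook_adj_def)
  moreover have "fst ` Z \<subseteq> {1..4}"
    using assms(1) by (auto simp: T4_def)
  ultimately have "card Z \<le> card {1..4::nat}"
    by (intro card_inj_on_le) auto
  then show ?thesis by simp
qed

section \<open>Lower bound: degree at most 5 is impossible\<close>

lemma positive_rank_degree_ge_6:
  assumes rank: "positive_rank T4 rook_adj D0"
  shows "div_degree T4 D0 \<ge> 6"
proof (rule ccontr)
  assume "\<not> div_degree T4 D0 \<ge> 6"
  then have deg0: "div_degree T4 D0 \<le> 5" by simp
  have corner: "(1,1) \<in> T4" by (simp add: T4_def)
  have bounds: "0 \<le> potential u" "potential u \<le> 4" for u
    by (auto simp: potential_def split: prod.splits)
  obtain D where eff: "effective T4 D" and deg: "div_degree T4 D = div_degree T4 D0"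
    and legal: "\<And>q. q \<in> T4 \<Longrightarrow> D q = 0 \<Longrightarrow> \<exists>U\<subseteq>T4. (1,1) \<in> U \<and> q \<notin> U \<and>
       (\<forall>u\<in>U. int (card (nbrs T4 rook_adj u - U)) \<le> D u)"
    using T4.exists_reduced_divisor[OF rank corner potential_subharmonic bounds] by metis
  define Z where "Z = {u \<in> T4. D u = 0}"
  have nonneg: "0 \<le> D u" if "u \<in> T4" for u
    using that eff by (simp add: effective_def)
  have "int (card (T4 - Z)) = (\<Sum>u\<in>T4 - Z. 1)" by simp
  also have "\<dots> \<le> (\<Sum>u\<in>T4 - Z. D u)"
    using nonneg by (intro sum_mono) (force simp: Z_def)
  also have "\<dots> \<le> div_degree T4 D"
    unfolding div_degree_def using nonneg T4.finite_V
    by (intro sum_mono2) auto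
  finally have "card (T4 - Z) \<le> 5" using deg deg0 by simp
  then have "card Z \<ge> 5"
    using card_Diff_subset[of Z T4] T4.finite_V card_T4 by (auto simp: Z_def)
  \<comment> \<open>In terms of \<open>A = T4 - U\<close>, legality says that every cell outside
    \<open>A\<close> has at least as many chips as neighbours in \<open>A\<close>.\<close>
  have complement: "\<exists>A. A \<subseteq> T4 - {(1,1)} \<and> q \<in> A \<and>
      (\<forall>u\<in>T4 - A. int (card {w \<in> A. rook_adj u w}) \<le> D u)" if q: "q \<in> Z" for q
  proof -
    obtain U where U: "U \<subseteq> T4" "(1,1) \<in> U" "q \<notin> U"
      and le: "\<forall>u\<in>U. int (card (nbrs T4 rook_adj u - U)) \<le> D u"
      using legal[of q] q by (auto simp: Z_def)
    have "{w \<in> T4 - U. rook_adj u w} = nbrs T4 rook_adj u - U" for u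
      by (auto simp: nbrs_def)
    moreover have "T4 - (T4 - U) = U" using U(1) by blast
    ultimately show ?thesis
      using U le q by (intro exI[of _ "T4 - U"]) (auto simp: Z_def)
  qed
  have cut: "int (rook_cut A) \<le> (\<Sum>u\<in>T4 - A. D u)" "(\<Sum>u\<in>T4 - A. D u) \<le> 5"
    if "A \<subseteq> T4 - {(1,1)}" "\<forall>u\<in>T4 - A. int (card {w \<in> A. rook_adj u w}) \<le> D u" for A
  proof -
    show "int (rook_cut A) \<le> (\<Sum>u\<in>T4 - A. D u)"
      unfolding rook_cut_def of_nat_sum using that(2) by (intro sum_mono) blast
    have "(\<Sum>u\<in>T4 - A. D u) \<le> div_degree T4 D"
      unfolding div_degree_def using nonneg T4.finite_V by (intro sum_mono2) auto
    then show "(\<Sum>u\<in>T4 - A. D u) \<le> 5" using deg deg0 by simp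
  qed
  \<comment> \<open>A chip-free cell outside \<open>A\<close> has no neighbour in \<open>A\<close>;
    hence \<open>A\<close> absorbs chip-free neighbours of its members.\<close>
  have in_A: "y \<in> A"
    if "A \<subseteq> T4 - {(1,1)}" "\<forall>u\<in>T4 - A. int (card {w \<in> A. rook_adj u w}) \<le> D u"
      "x \<in> A" "y \<in> Z" "rook_adj y x" for A x y
  proof (rule ccontr)
    assume "y \<notin> A"
    then have "int (card {w \<in> A. rook_adj y w}) \<le> 0"
      using that(2,4) by (force simp: Z_def)
    moreover have "finite A" using that(1) T4.finite_V finite_subset by blast
    ultimately have "{w \<in> A. rook_adj y w} = {}" by simp
    then show False using that(3,5) by blast
  qed
  obtain x y where xy: "x \<in> Z" "y \<in> Z" "rook_adj y x"
    using card_independent_le_4[of Z] \<open>card Z \<ge> 5\<close> by (force simp: Z_def)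
  obtain A where A: "A \<subseteq> T4 - {(1,1)}" "x \<in> A"
    and le: "\<forall>u\<in>T4 - A. int (card {w \<in> A. rook_adj u w}) \<le> D u"
    using complement[OF xy(1)] by blast
  have "y \<in> A" using in_A[OF A(1) le A(2) xy(2,3)] .
  moreover have "x \<noteq> y" using xy(3) by (auto simp: rook_adj_def)
  ultimately have "card A \<noteq> 1" using A(2) by (auto simp: card_1_singleton_iff)
  then have five: "rook_cut A = 5"
    and "\<exists>p\<in>far A. card {r \<in> far A. rook_adj p r} \<ge> 2"
    using low_cut[OF A(1)] cut[OF A(1) le] A(2) by auto
  then obtain p where p: "p \<in> far A" and two: "card {r \<in> far A. rook_adj p r} \<ge> 2" by blast
  \<comment> \<open>A far cell contributes nothing to the cut, and the five cut edges already
    require five chips on the other cells outside \<open>A\<close>, so none is left for it.\<close>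
  have farZ: "u \<in> Z" if "u \<in> far A" for u
  proof -
    have u: "u \<in> T4 - A" "{w \<in> A. rook_adj u w} = {}"
      using that by (auto simp: far_def)
    have "5 = (\<Sum>v\<in>T4 - A - {u}. int (card {w \<in> A. rook_adj v w}))"
      using five u(1) T4.finite_V
      by (simp add: rook_cut_def sum.remove[of "T4 - A" u] u(2) flip: of_nat_sum)
    also have "\<dots> \<le> (\<Sum>v\<in>T4 - A - {u}. D v)"
      using le by (intro sum_mono) blast
    also have "\<dots> = (\<Sum>v\<in>T4 - A. D v) - D u"
      using u T4.finite_V by (simp add: sum.remove[of "T4 - A" u])
    finally have "D u \<le> 0" using cut(2)[OF A(1) le] by simp
    then show ?thesis using nonneg[of u] u by (simp add: Z_def)
  qed
  obtain B where B: "B \<subseteq> T4 - {(1,1)}" "p \<in> B"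
    and leB: "\<forall>u\<in>T4 - B. int (card {w \<in> B. rook_adj u w}) \<le> D u"
    using complement[OF farZ[OF p]] by blast
  have "finite B" using B(1) T4.finite_V finite_subset by blast
  \<comment> \<open>Absorption forces \<open>p\<close> and its two far neighbours into
    \<open>B\<close>, while sets of such low cut have at most two cells.\<close>
  have "insert p {r \<in> far A. rook_adj p r} \<subseteq> B"
    using in_A[OF B(1) leB B(2) farZ] B(2) T4.adj_sym by blast
  moreover have "finite {r \<in> far A. rook_adj p r}" "p \<notin> {r \<in> far A. rook_adj p r}"
    using T4.finite_V by (auto simp: far_def rook_adj_def)
  ultimately have "card B \<ge> 3"
    using card_mono[OF \<open>finite B\<close>, of "insert p {r \<in> far A. rook_adj p r}"] two by simp
  moreover have "card B = 1 \<or> card B = 2"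
    using low_cut[OF B(1)] cut[OF B(1) leB] B(2) by auto
  ultimately show False by simp
qed

section \<open>Upper bound: a divisor of degree 6 and positive rank\<close>

lemma positive_rank_degree_6:
  defines "D \<equiv> \<lambda>u. if u \<in> T4 \<and> fst u + snd u \<le> 4 then 1 else (0::int)"
  shows "is_divisor T4 D" "div_degree T4 D = 6" "positive_rank T4 rook_adj D"
proof -
  show "is_divisor T4 D" by (auto simp: is_divisor_def D_def)
  show "div_degree T4 D = 6" by (simp add: div_degree_def D_def T4_eq cells_def)
  show "positive_rank T4 rook_adj D"
    unfolding positive_rank_def
  proof
    fix v assume v: "v \<in> T4"
    show "\<exists>D'\<in>linsys T4 rook_adj D. D' v > 0"
    proof (cases "fst v + snd v \<le> 4")
      case True
      have "D \<in> linsys T4 rook_adj D"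
        by (auto simp: linsys_def div_equiv_def effective_def D_def)
      moreover have "D v > 0" using True v by (simp add: D_def)
      ultimately show ?thesis by blast
    next
      case False
      define D' where "D' = fire_script T4 rook_adj (\<lambda>u. if u \<in> T4 - {v} then 1 else 0) D"
      have diag: "fst v + snd v = 5" using v False by (auto simp: T4_def)
      have legal: "int (card (nbrs T4 rook_adj u - (T4 - {v}))) \<le> D u" if "u \<in> T4 - {v}" for u
      proof (cases "rook_adj u v")
        case True
        then have "nbrs T4 rook_adj u - (T4 - {v}) = {v}" using v by (auto simp: nbrs_def)
        \<comment> \<open>Distinct cells on the outermost diagonal share no line, so a neighbour of
          \<open>v\<close> lies below it and owns the single chip it sends to
          \<open>v\<close>.\<close>
        moreover have "fst u + snd u \<le> 4"
          using True that diag by (cases u; cases v) (auto simp: T4_def rook_adj_def)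
        ultimately show ?thesis using that by (simp add: D_def)
      next
        case False
        then have "nbrs T4 rook_adj u - (T4 - {v}) = {}" by (auto simp: nbrs_def)
        then show ?thesis by (simp only:) (simp add: D_def)
      qed
      have "effective T4 D'"
        unfolding D'_def using legal
        by (intro T4.effective_fire_set) (blast, simp add: effective_def D_def, blast)
      moreover have "div_equiv T4 rook_adj D D'"
        unfolding D'_def by (rule T4.div_equiv_fire_set) auto
      moreover have "D' v > 0"
      proof -
        \<comment> \<open>One neighbour suffices for a gain; \<open>v\<close> cannot equal both
          border cells of its lines, as it is not the corner.\<close>
        have "(1, snd v) \<in> nbrs T4 rook_adj v \<or> (fst v, 1) \<in> nbrs T4 rook_adj v"
          using v diag by (cases v) (auto simp: nbrs_def T4_def rook_adj_def)
        then have "lapl T4 rook_adj (\<lambda>u. if u \<in> T4 - {v} then 1 else 0) v > 0"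
          unfolding lapl_def
          using T4.finite_nbrs by (intro sum_pos) (auto simp: nbrs_def rook_adj_def)
        then show ?thesis using v by (simp add: D'_def fire_script_def D_def)
      qed
      ultimately show ?thesis by (auto simp: linsys_def)
    qed
  qed
qed

theorem theorem4p4:
  shows "gonality T4 rook_adj = 6"
  unfolding gonality_def
proof (rule Least_equality)
  show "\<exists>D. is_divisor T4 D \<and> div_degree T4 D = int 6 \<and> positive_rank T4 rook_adj D"
    using positive_rank_degree_6 by (intro exI conjI) (assumption | simp)+
next
  fix k assume "\<exists>D. is_divisor T4 D \<and> div_degree T4 D = int k \<and> positive_rank T4 rook_adj D"
  then show "6 \<le> k" using positive_rank_degree_ge_6 by fastforce
qed

end
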